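(* The minimal weight $d$ of a self-dual linear Kleinian code $C$ of length $n$ satisfies $d\le\lfloor n/2\rfloor+1$.
   Context: Let $K=\{0,a,b,c\}$ be the Kleinian four-group. A linear code of length $n$ is a subgroup $C\subseteq K^n$; $\mathrm{wt}(\mathbf{x})$ is the number of nonzero coordinates, and the minimal weight is $d=\min\{\mathrm{wt}(\mathbf{x}):\mathbf{x}\in C,\mathbf{x}\neq0\}$. Define $x\cdot y\in\mathbb{F}_2$ for $x,y\in K$ by $x\cdot y=1$ iff $x,y$ are nonzero and distinct; $(\mathbf{x},\mathbf{y})=\sum_ix_i\cdot y_i$; $C^\perp=\{\mathbf{x}:(\mathbf{x},\mathbf{y})=0\ \forall \mathbf{y}\in C\}$; $C$ is self-dual if $C=C^\perp$. *)

theory Defs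
  imports "HOL-Library.Z2" "HOL-Analysis.Finite_Cartesian_Product"
begin

datatype klein = K0 | Ka | Kb | Kc

instantiation klein :: ab_group_add
begin

definition zero_klein :: klein where
  "0 = K0"

fun plus_klein :: "klein \<Rightarrow> klein \<Rightarrow> klein" where
  "K0 + y = y"
| "x + K0 = x"
| "Ka + Ka = K0" | "Ka + Kb = Kc" | "Ka + Kc = Kb"
| "Kb + Ka = Kc" | "Kb + Kb = K0" | "Kb + Kc = Ka"
| "Kc + Ka = Kb" | "Kc + Kb = Ka" | "Kc + Kc = K0"

definition uminus_klein :: "klein \<Rightarrow> klein" where
  "- x = (x :: klein)"

definition minus_klein :: "klein \<Rightarrow> klein \<Rightarrow> klein" where
  "x - y = x + (y :: klein)"

instance
proof
  fix x y z :: klein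
  show "x + y + z = x + (y + z)"
    by (cases x; cases y; cases z) simp_all
  show "x + y = y + x"
    by (cases x; cases y) simp_all
  show "0 + x = x"
    by (simp add: zero_klein_def)
  show "- x + x = 0"
    by (cases x) (simp_all add: zero_klein_def uminus_klein_def)
  show "x - y = x + - y"
    by (simp add: minus_klein_def uminus_klein_def)
qed

end

instance klein :: finite
proof
  have "(UNIV :: klein set) = {K0, Ka, Kb, Kc}"
    using klein.exhaust by blast
  then show "finite (UNIV :: klein set)"
    by (metis finite.emptyI finite.insertI)
qed

definition klein_dot :: "klein \<Rightarrow> klein \<Rightarrow> bit" where
  "klein_dot x y = of_bool (x \<noteq> 0 \<and> y \<noteq> 0 \<and> x \<noteq> y)"

(* The type bit is the field with two elements, so the sum is taken modulo 2. *)
definition klein_form :: "klein ^ 'n::finite \<Rightarrow> klein ^ 'n \<Rightarrow> bit" where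
  "klein_form x y = (\<Sum>i\<in>UNIV. klein_dot (x $ i) (y $ i))"

definition linear_code :: "(klein ^ 'n::finite) set \<Rightarrow> bool" where
  "linear_code C \<longleftrightarrow>
     0 \<in> C \<and> (\<forall>x\<in>C. \<forall>y\<in>C. x + y \<in> C) \<and> (\<forall>x\<in>C. - x \<in> C)"

definition dual_code :: "(klein ^ 'n::finite) set \<Rightarrow> (klein ^ 'n) set" where
  "dual_code C = {x. \<forall>y\<in>C. klein_form x y = 0}"

definition self_dual :: "(klein ^ 'n::finite) set \<Rightarrow> bool" where
  "self_dual C \<longleftrightarrow> C = dual_code C"

definition wt :: "klein ^ 'n::finite \<Rightarrow> nat" where
  "wt x = card {i. x $ i \<noteq> 0}"

(* Meaningful only when C has a nonzero codeword.  The zero code is not self-dual,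
   because the length CARD('n) is at least 1. *)
definition min_weight :: "(klein ^ 'n::finite) set \<Rightarrow> nat" where
  "min_weight C = Min {wt x |x. x \<in> C \<and> x \<noteq> 0}"

end

theory Submission
  imports Defs "HOL-Library.FuncSet"
begin

text \<open>
  Summing the characters \<open>(-1)\<^bsup>(x,y)\<^esup>\<close> over all words \<open>x\<close> and all codewords \<open>y\<close> in both orders
  gives \<open>|C| |C\<^sup>\<bottom>| = 4\<^sup>n\<close>, so a self-dual code has \<open>2\<^sup>n\<close> codewords. If no nonzero codeword were
  supported on a fixed set of \<open>m = \<lfloor>n/2\<rfloor> + 1\<close> coordinates, deleting these coordinates would be
  injective on \<open>C\<close>, whence \<open>2\<^sup>n \<le> 4\<^bsup>n-m\<^esup> < 2\<^sup>n\<close>.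
\<close>

lemma card_klein: "CARD(klein) = 4"
proof -
  have "(UNIV :: klein set) = {K0, Ka, Kb, Kc}"
    using klein.exhaust by blast
  show ?thesis
    unfolding \<open>UNIV = _\<close> by simp
qed

lemma klein_dot_add_left: "klein_dot (x + y) z = klein_dot x z + klein_dot y z"
  by (cases x; cases y; cases z) (simp_all add: klein_dot_def zero_klein_def)

lemma klein_dot_commute: "klein_dot x y = klein_dot y x"
  by (auto simp: klein_dot_def)

lemma klein_dot_zero_left [simp]: "klein_dot 0 y = 0"
  by (simp add: klein_dot_def)

lemma klein_dot_nondegenerate:
  assumes "y \<noteq> 0"
  obtains x where "klein_dot x y = 1"
proof
  \<comment> \<open>Any nonzero element other than \<open>y\<close> works.\<close>
  show "klein_dot (if y = Ka then Kb else Ka) y = 1"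
    using assms by (cases y) (simp_all add: klein_dot_def zero_klein_def)
qed

lemma klein_form_add_left: "klein_form (x + y) z = klein_form x z + klein_form y z"
  unfolding klein_form_def sum.distrib[symmetric] by (simp only: vector_add_component klein_dot_add_left)

lemma klein_form_commute: "klein_form x y = klein_form y x"
  unfolding klein_form_def by (subst klein_dot_commute) (rule refl)

lemma klein_form_zero_right [simp]: "klein_form x 0 = 0"
  by (subst klein_form_commute) (simp add: klein_form_def)

lemma klein_form_nondegenerate:
  fixes y :: "klein ^ 'n::finite"
  assumes "y \<noteq> 0"
  obtains x where "klein_form x y = 1"
proof -
  obtain i where "y $ i \<noteq> 0"
    using assms by (auto simp: vec_eq_iff)
  then obtain k where k: "klein_dot k (y $ i) = 1"
    by (rule klein_dot_nondegenerate)
  \<comment> \<open>The witness is supported on the single coordinate \<open>i\<close>, so only one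
    summand of the form survives.\<close>
  have "klein_form (\<chi> j. if j = i then k else 0) y
      = (\<Sum>j\<in>UNIV. if j = i then klein_dot k (y $ i) else 0)"
    unfolding klein_form_def by (intro sum.cong) auto
  with k show ?thesis
    by (intro that) simp
qed

lemma linear_code_UNIV: "linear_code UNIV"
  by (simp add: linear_code_def)

lemma linear_code_diff:
  assumes "linear_code C" "x \<in> C" "y \<in> C"
  shows "x - y \<in> C"
  using assms unfolding linear_code_def diff_conv_add_uminus by blast

text \<open>The nontrivial character of the two-element field, with integer values so that sums can
  cancel.\<close>

definition bit_sign :: "bit \<Rightarrow> int" where
  "bit_sign b = (if b = 0 then 1 else -1)"

lemma bit_sign_simps [simp]: "bit_sign 0 = 1" "bit_sign 1 = -1"
  by (simp_all add: bit_sign_def)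

lemma bit_sign_add: "bit_sign (a + b) = bit_sign a * bit_sign b"
  by (cases a; cases b) simp_all

text \<open>Translation by \<open>x0\<close> permutes \<open>C\<close> and flips every sign, so the
  sum equals its own negative.\<close>

lemma sum_bit_sign_eq_0:
  assumes C: "linear_code C" and x0: "x0 \<in> C" and odd: "klein_form x0 y = 1"
  shows "(\<Sum>x\<in>C. bit_sign (klein_form x y)) = 0"
proof -
  have "bij_betw (\<lambda>x. x0 + x) C C"
    by (rule bij_betw_byWitness[where f' = "\<lambda>x. x - x0"])
       (use C x0 in \<open>auto simp: linear_code_diff linear_code_def\<close>)
  then have "(\<Sum>x\<in>C. bit_sign (klein_form x y)) = (\<Sum>x\<in>C. bit_sign (klein_form (x0 + x) y))"
    by (rule sum.reindex_bij_betw[symmetric])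
  also have "\<dots> = - (\<Sum>x\<in>C. bit_sign (klein_form x y))"
    unfolding klein_form_add_left bit_sign_add odd by (simp add: sum_negf)
  finally show ?thesis
    by simp
qed

lemma sum_bit_sign_UNIV:
  fixes y :: "klein ^ 'n::finite"
  shows "(\<Sum>x\<in>UNIV. bit_sign (klein_form x y)) = (if y = 0 then 4 ^ CARD('n) else 0)"
proof (cases "y = 0")
  case True
  then show ?thesis
    by (simp add: card_klein)
next
  case False
  then obtain x where "klein_form x y = 1"
    by (rule klein_form_nondegenerate)
  with False show ?thesis
    using sum_bit_sign_eq_0[OF linear_code_UNIV] by auto
qed

text \<open>A word outside the dual pairs to 1 with some codeword; symmetry of the form then lets
  that codeword serve as the translation.\<close>

lemma sum_bit_sign_code:
  assumes "linear_code C"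
  shows "(\<Sum>y\<in>C. bit_sign (klein_form x y)) = (if x \<in> dual_code C then int (card C) else 0)"
proof (cases "x \<in> dual_code C")
  case True
  then show ?thesis
    by (simp add: dual_code_def)
next
  case False
  then obtain y where "y \<in> C" "klein_form y x = 1"
    by (auto simp: dual_code_def klein_form_commute)
  then have "(\<Sum>y\<in>C. bit_sign (klein_form y x)) = 0"
    by (rule sum_bit_sign_eq_0[OF assms])
  with False show ?thesis
    by (simp add: klein_form_commute)
qed

lemma card_code_mult_card_dual:
  fixes C :: "(klein ^ 'n::finite) set"
  assumes "linear_code C"
  shows "card C * card (dual_code C) = 4 ^ CARD('n)"
proof -
  have "int (card C * card (dual_code C))
      = (\<Sum>x\<in>UNIV. if x \<in> dual_code C then int (card C) else 0)"
    by (simp add: sum.If_cases)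
  also have "\<dots> = (\<Sum>x\<in>UNIV. \<Sum>y\<in>C. bit_sign (klein_form x y))"
    by (simp only: sum_bit_sign_code[OF assms])
  also have "\<dots> = (\<Sum>y\<in>C. \<Sum>x\<in>UNIV. bit_sign (klein_form x y))"
    by (rule sum.swap)
  also have "\<dots> = (\<Sum>y\<in>C. if y = 0 then 4 ^ CARD('n) else 0)"
    by (simp only: sum_bit_sign_UNIV)
  \<comment> \<open>Only \<open>y = 0\<close> contributes, and it lies in \<open>C\<close> by
    linearity.\<close>
  also have "\<dots> = int (4 ^ CARD('n))"
    using assms by (simp add: linear_code_def)
  finally show ?thesis
    by (simp only: of_nat_eq_iff)
qed

lemma min_weight_le_wt:
  assumes "x \<in> C" and "x \<noteq> 0"
  shows "min_weight C \<le> wt x"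
  unfolding min_weight_def using assms by (intro Min_le) auto

lemma card_code_le:
  fixes C :: "(klein ^ 'n::finite) set" and S :: "'n set"
  assumes C: "linear_code C" and S: "card S < min_weight C"
  shows "card C \<le> 4 ^ (CARD('n) - card S)"
proof -
  \<comment> \<open>Deleting coordinates is modelled by restriction: the value on \<open>S\<close>
    is a fixed default, so the images lie in an extensional function space that can be
    counted.\<close>
  have "inj_on (\<lambda>x. (\<lambda>i\<in>- S. x $ i)) C"
  proof (rule inj_onI)
    fix x y
    assume xy: "x \<in> C" "y \<in> C" and eq: "(\<lambda>i\<in>- S. x $ i) = (\<lambda>i\<in>- S. y $ i)"
    have "x $ i = y $ i" if "i \<notin> S" for i
      using fun_cong[OF eq, of i] that by simp
    then have "{i. (x - y) $ i \<noteq> 0} \<subseteq> S"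
      by auto
    then have "wt (x - y) \<le> card S"
      unfolding wt_def by (intro card_mono) auto
    moreover have "x - y \<in> C"
      using C xy by (rule linear_code_diff)
    \<comment> \<open>Were \<open>x - y\<close> nonzero, its weight would be at least
      \<open>min_weight C\<close>, which exceeds \<open>card S\<close>.\<close>
    ultimately show "x = y"
      using min_weight_le_wt[of "x - y" C] S by fastforce
  qed
  then have "card C \<le> card (- S \<rightarrow>\<^sub>E (UNIV :: klein set))"
    by (rule card_inj_on_le) (auto intro: finite_PiE)
  also have "\<dots> = 4 ^ (CARD('n) - card S)"
    by (simp add: card_PiE card_klein Compl_eq_Diff_UNIV card_Diff_subset)
  finally show ?thesis .
qed

theorem theorem11:
  fixes C :: "(klein ^ 'n::finite) set"
  assumes "linear_code C" and "self_dual C"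
  shows "min_weight C \<le> CARD('n) div 2 + 1"
proof (rule ccontr)
  assume less: "\<not> ?thesis"
  let ?n = "CARD('n)" and ?m = "CARD('n) div 2 + 1"
  have "0 < ?n"
    by simp
  \<comment> \<open>A set of \<open>?m\<close> coordinates exists because the length is positive;
    for length 1 it is the whole index set.\<close>
  then have "?m \<le> ?n"
    by linarith
  then obtain S :: "'n set" where S: "card S = ?m"
    by (meson obtain_subset_with_card_n)
  then have le: "card C \<le> 4 ^ (?n - ?m)"
    using card_code_le[OF assms(1), of S] less by simp
  have "4 ^ ?n = card C * card C"
    using card_code_mult_card_dual[OF assms(1)] assms(2) by (simp add: self_dual_def)
  also have "\<dots> \<le> 4 ^ (?n - ?m) * 4 ^ (?n - ?m)"
    using le by (intro mult_mono) simp_all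
  also have "\<dots> = 4 ^ (2 * (?n - ?m))"
    by (simp add: mult_2 power_add)
  \<comment> \<open>Rounding down and adding 1 gives \<open>2 * ?m > ?n\<close>, hence
    \<open>2 * (?n - ?m) < ?n\<close>.\<close>
  also have "\<dots> < (4::nat) ^ ?n"
    using \<open>0 < ?n\<close> by (intro power_strict_increasing) linarith+
  finally show False
    by simp
qed

end
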